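(* Let $n,m\ge 1$, let $\rho>0$, $\lambda>0$, $a\in\mathbb{R}^n$, $b\in\mathbb{R}^m$, and let $A_I, A_I^\ast, B_I, B_I^\ast$ be the interval matrix sets and $K_1(\cdot),K_2(\cdot)$ the set-valued mappings described in the context (assumption (A1)). Suppose that: (A2) $1-\rho\,\overline{a}_{ii}\ge h_{ii}$ for $i=1,\dots,n$; (A3) $1-\lambda\,\overline{b}_{jj}\ge l_{jj}$ for $j=1,\dots,m$; (A4) there exist constants $\mu_i>0$ $(i=1,\dots,n)$ and $\tau_j>0$ $(j=1,\dots,m)$ such that, for $i=1,\dots,n$, $$0<1-\rho\,\underline{a}_{ii}-h_{ii}+|h_{ii}|+\sum_{j=1,\,j\ne i}^n\frac{\mu_j}{\mu_i}\left(\widetilde a_{ji}+|h_{ji}|\right)+\sum_{j=1}^m\frac{\tau_j}{\mu_i}\lambda\,\widetilde{b^\ast}_{ji}<1,$$ and, for $j=1,\dots,m$, $$0<1-\lambda\,\underline{b}_{jj}-l_{jj}+|l_{jj}|+\sum_{i=1,\,i\ne j}^m\frac{\tau_i}{\tau_j}\left(\widetilde b_{ij}+|l_{ij}|\right)+\sum_{i=1}^n\frac{\mu_i}{\tau_j}\rho\,\widetilde{a^\ast}_{ij}<1,$$ where $$\widetilde a_{ji}=\max\{|\rho\underline a_{ji}+h_{ji}|,|\rho\overline a_{ji}+h_{ji}|\},\qquad \widetilde{a^\ast}_{ij}=\max\{|\underline{a^\ast}_{ij}|,|\overline{a^\ast}_{ij}|\},$$ $$\widetilde b_{ij}=\max\{|\lambda\underline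 b_{ij}+l_{ij}|,|\lambda\overline b_{ij}+l_{ij}|\},\qquad \widetilde{b^\ast}_{ji}=\max\{|\underline{b^\ast}_{ji}|,|\overline{b^\ast}_{ji}|\}.$$ Then for each $A\in A_I$, $A^\ast\in A_I^\ast$, $B\in B_I$ and $B^\ast\in B_I^\ast$, the system (FIIPNN) of the context has a unique equilibrium point, i.e. there is exactly one $(x^\ast,y^\ast)\in\mathbb{R}^n\times\mathbb{R}^m$ with $$P_{K_1(x^\ast)}\left[x^\ast-\rho(Ax^\ast+A^\ast y^\ast)-\rho a\right]=x^\ast,\qquad P_{K_2(y^\ast)}\left[y^\ast-\lambda(By^\ast+B^\ast x^\ast)-\lambda b\right]=y^\ast .$$
   Context: Interval matrices. Real matrices $\underline A\le\overline A$ ($n\times n$), $\underline{A^\ast}\le\overline{A^\ast}$ ($n\times m$), $\underline B\le\overline B$ ($m\times m$), $\underline{B^\ast}\le\overline{B^\ast}$ ($m\times n$) are given, inequalities being entrywise, with entries denoted $\underline a_{ij},\overline a_{ij}$, $\underline{a^\ast}_{ij},\overline{a^\ast}_{ij}$, $\underline b_{ij},\overline b_{ij}$, $\underline{b^\ast}_{ij},\overline{b^\ast}_{ij}$. Put $A_I=\{A\in\mathbb{R}^{n\times n}:\underline A\le A\le\overline A\}$, $A_I^\ast=\{A^\ast\in\mathbb{R}^{n\times m}:\underline{A^\ast}\le A^\ast\le\overline{A^\ast}\}$, $B_I=\{B\in\mathbb{R}^{m\times m}:\underline B\le B\le\overline B\}$, $B_I^\ast=\{B^\ast\in\mathbb{R}^{m\times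 n}:\underline{B^\ast}\le B^\ast\le\overline{B^\ast}\}$. (The star in $A^\ast,B^\ast$ is only part of the name, not an adjoint.) Assumption (A1) on the constraint sets. Real constants $h_{ij}$ ($1\le i,j\le n$), $l_{ji}$ ($1\le i,j\le m$), $c_{1,i}\le c_{2,i}$ ($1\le i\le n$), $d_{1,j}\le d_{2,j}$ ($1\le j\le m$) are given, and for $x\in\mathbb{R}^n$, $y\in\mathbb{R}^m$, $$K_1(x)=u^1(x)+K_1,\quad K_2(y)=u^2(y)+K_2,\quad u^1_i(x)=\sum_{j=1}^n h_{ij}x_j,\quad u^2_j(y)=\sum_{i=1}^m l_{ji}y_i,$$ $$K_1=\{x\in\mathbb{R}^n: c_{1,i}\le x_i\le c_{2,i},\ i=1,\dots,n\},\quad K_2=\{y\in\mathbb{R}^m: d_{1,j}\le y_j\le d_{2,j},\ j=1,\dots,m\},$$ where $v+K=\{v+w:w\in K\}$. Projection. For a nonempty closed convex set $K\subset\mathbb{R}^d$, $P_K[y]=\arg\min_{z\in K}\|y-z\|$ is the Euclidean metric projection; $P_{K(x)}$ is the projection onto $K(x)$. System (FIIPNN). For $\alpha\in(0,1)$ and given $A\in A_I$, $A^\ast\in A_I^\ast$, $B\in B_I$, $B^\ast\in B_I^\ast$, for $t\ge0$, $${}_0^CD_t^\alpha x(t)=P_{K_1(x(t))}[x(t)-\rho(Ax(t)+A^\ast y(t))-\rho a]-x(t),\quad x(0)=x_0,$$ $${}_0^CD_t^\alpha y(t)=P_{K_2(y(t))}[y(t)-\lambda(By(t)+B^\ast x(t))-\lambda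 b]-y(t),\quad y(0)=y_0,$$ where ${}_0^CD_t^\alpha$ is the Caputo derivative of order $\alpha$. An equilibrium point of the system with given $A,A^\ast,B,B^\ast$ is a pair $(x^\ast,y^\ast)$ satisfying the two fixed-point equations displayed in the claim. *)

theory Defs
  imports "HOL-Analysis.Analysis"
begin

text \<open>
  An \<open>r \<times> s\<close> matrix has type \<open>real ^ 's ^ 'r\<close>. The order on \<open>real ^ 'd\<close> is componentwise and hence the
  order on matrices is entrywise, so \<open>{X..Y}\<close> is the interval matrix set with bounds \<open>X\<close> and \<open>Y\<close>,
  and for vectors it is a box. \<open>closest_point K\<close> is the Euclidean metric projection onto \<open>K\<close>; it is
  only applied to nonempty compact boxes, where it is uniquely determined.
\<close>

definition moving_box :: "real ^ 'd ^ 'd \<Rightarrow> real ^ 'd \<Rightarrow> real ^ 'd \<Rightarrow> real ^ 'd \<Rightarrow> (real ^ 'd) set"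
  where "moving_box H lo hi x = (\<lambda>w. H *v x + w) ` {lo..hi}"

text \<open>
  A pair \<open>(x, y)\<close> at which the right-hand sides of the fractional-order system vanish. The order of
  the Caputo derivative and the initial values play no role here.
\<close>

definition equilibrium_point ::
  "(real ^ 'n \<Rightarrow> (real ^ 'n) set) \<Rightarrow> (real ^ 'm \<Rightarrow> (real ^ 'm) set) \<Rightarrow> real \<Rightarrow> real \<Rightarrow>
   real ^ 'n \<Rightarrow> real ^ 'm \<Rightarrow> real ^ 'n ^ 'n \<Rightarrow> real ^ 'm ^ 'n \<Rightarrow> real ^ 'm ^ 'm \<Rightarrow> real ^ 'n ^ 'm \<Rightarrow>
   (real ^ 'n) \<times> (real ^ 'm) \<Rightarrow> bool"
  where "equilibrium_point K1 K2 \<rho> lam a b A As B Bs = (\<lambda>(x, y).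
    closest_point (K1 x) (x - \<rho> *\<^sub>R (A *v x + As *v y) - \<rho> *\<^sub>R a) = x \<and>
    closest_point (K2 y) (y - lam *\<^sub>R (B *v y + Bs *v x) - lam *\<^sub>R b) = y)"

definition entry_bound :: "real ^ 's ^ 'r \<Rightarrow> real ^ 's ^ 'r \<Rightarrow> 'r \<Rightarrow> 's \<Rightarrow> real"
  where "entry_bound X Y i j = max \<bar>X $ i $ j\<bar> \<bar>Y $ i $ j\<bar>"

definition shifted_entry_bound ::
  "real \<Rightarrow> real ^ 'd ^ 'd \<Rightarrow> real ^ 'd ^ 'd \<Rightarrow> real ^ 'd ^ 'd \<Rightarrow> 'd \<Rightarrow> 'd \<Rightarrow> real"
  where "shifted_entry_bound r H X Y i j =
    max \<bar>r * X $ i $ j + H $ i $ j\<bar> \<bar>r * Y $ i $ j + H $ i $ j\<bar>"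

end

theory Submission
  imports Defs
begin

text \<open>
  The projection onto a translated box acts coordinatewise as a translated clamp, which is
  \<open>1\<close>-Lipschitz in each coordinate. Hence the map whose fixed points are the equilibria has an
  entrywise matrix Lipschitz bound, and (A4) says exactly that the weighted column sums of that matrix
  are below \<open>1\<close>: the map is a contraction for the norm
  \<open>(\<Sum>i. \<mu> i * \<bar>x $ i\<bar>) + (\<Sum>j. \<tau> j * \<bar>y $ j\<bar>)\<close>. (A2) and (A3) give the sign of the diagonal terms.
\<close>

section \<open>Fixed points of maps contracting in a comparable norm\<close>

text \<open>
  A high iterate of \<open>T\<close> is a contraction for the original norm.
\<close>

lemma banach_fix_equivalent_norm:
  fixes T :: "'a::banach \<Rightarrow> 'a" and N :: "'a \<Rightarrow> real"
  assumes C: "0 \<le> C" "\<And>v. norm v \<le> C * N v"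
    and D: "0 \<le> D" "\<And>v. N v \<le> D * norm v"
    and q: "0 \<le> q" "q < 1"
    and contr: "\<And>u v. N (T u - T v) \<le> q * N (u - v)"
  shows "\<exists>!p. T p = p"
proof -
  have pow: "N ((T ^^ k) u - (T ^^ k) v) \<le> q ^ k * N (u - v)" for k u v
  proof (induction k)
    case (Suc k)
    have "N ((T ^^ Suc k) u - (T ^^ Suc k) v) \<le> q * N ((T ^^ k) u - (T ^^ k) v)"
      using contr by simp
    also have "\<dots> \<le> q * (q ^ k * N (u - v))"
      using Suc q(1) by (rule mult_left_mono)
    finally show ?case by (simp add: mult.assoc)
  qed simp
  \<comment> \<open>Passing from \<open>norm\<close> to \<open>N\<close> and back costs the fixed
    factor \<open>C * D\<close>; the power \<open>q ^ k\<close> eventually outweighs it.\<close>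
  have "(\<lambda>k. C * D * q ^ k) \<longlonglongrightarrow> C * D * 0"
    using q by (intro tendsto_mult_left LIMSEQ_realpow_zero)
  then have "\<forall>\<^sub>F k in sequentially. C * D * q ^ k < 1"
    by (rule order_tendstoD) simp
  then obtain k where k: "C * D * q ^ k < 1"
    by (auto simp: eventually_sequentially)
  have "dist ((T ^^ k) u) ((T ^^ k) v) \<le> C * D * q ^ k * dist u v" for u v
  proof -
    have "norm ((T ^^ k) u - (T ^^ k) v) \<le> C * N ((T ^^ k) u - (T ^^ k) v)"
      by (rule C)
    also have "\<dots> \<le> C * (q ^ k * (D * norm (u - v)))"
      using pow[of k u v] D(2)[of "u - v"] C(1) q(1)
      by (meson mult_left_mono order_trans zero_le_power)
    finally show ?thesis by (simp add: dist_norm mult_ac)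
  qed
  then have "\<exists>!p. (T ^^ k) p = p"
    using C(1) D(1) q(1) k by (intro banach_fix_type[of "C * D * q ^ k"]) auto
  then obtain p where p: "(T ^^ k) p = p" and uniq: "\<And>u. (T ^^ k) u = u \<Longrightarrow> u = p"
    by blast
  \<comment> \<open>\<open>T\<close> commutes with its iterates, so \<open>T p\<close> is again a
    fixed point of \<open>T ^^ k\<close> and must equal \<open>p\<close>.\<close>
  have "T p = p"
    using p by (intro uniq) (metis funpow_swap1)
  moreover have "u = p" if "T u = u" for u
  proof (rule uniq)
    show "(T ^^ k) u = u" using that by (induction k) auto
  qed
  ultimately show ?thesis by blast
qed

section \<open>Projection onto a translated box\<close>

text \<open>A box is a product of intervals, so the nearest point can be chosen in each coordinate
  separately: a vector that is closest in every coordinate is closest in the Euclidean norm.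
  Convexity makes it the only closest point.\<close>

lemma closest_point_moving_box_nth:
  fixes lo hi :: "real ^ 'd"
  assumes "lo \<le> hi"
  shows "closest_point (moving_box H lo hi x) z $ i =
    (H *v x) $ i + max (lo $ i) (min (hi $ i) (z $ i - (H *v x) $ i))"
proof -
  define w where "w = (\<chi> i. max (lo $ i) (min (hi $ i) (z $ i - (H *v x) $ i)))"
  have box: "moving_box H lo hi x = (+) (H *v x) ` cbox lo hi"
    unfolding moving_box_def interval_cbox_cart ..
  have le: "lo $ i \<le> hi $ i" for i
    using assms by (simp add: less_eq_vec_def)
  have "H *v x + w = closest_point (moving_box H lo hi x) z"
  proof (rule closest_point_unique)
    show "convex (moving_box H lo hi x)" "closed (moving_box H lo hi x)"
      unfolding box by (auto intro: convex_translation closed_translation closed_cbox)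
    show "H *v x + w \<in> moving_box H lo hi x"
      unfolding moving_box_def w_def using le by (auto simp: less_eq_vec_def)
    show "\<forall>v\<in>moving_box H lo hi x. dist z (H *v x + w) \<le> dist z v"
      unfolding moving_box_def dist_norm
      by (auto intro!: norm_le_componentwise_cart simp: less_eq_vec_def w_def)
         (smt (verit, best))
  qed
  then show ?thesis
    by (metis vector_add_component vec_lambda_beta w_def)
qed

section \<open>Coordinatewise Lipschitz bound for one block\<close>

text \<open>One block of the fixed-point map, with \<open>x\<close> the block's own variable and
  \<open>y\<close> the other one. The dimensions are independent, so the same bound serves both
  equations with the roles exchanged.\<close>

definition projection_step ::
  "real ^ 'd ^ 'd \<Rightarrow> real ^ 'd \<Rightarrow> real ^ 'd \<Rightarrow> real \<Rightarrow> real ^ 'd \<Rightarrow> real ^ 'd ^ 'd \<Rightarrow> real ^ 'e ^ 'd \<Rightarrow>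
   real ^ 'd \<Rightarrow> real ^ 'e \<Rightarrow> real ^ 'd"
  where "projection_step H lo hi r a A As x y =
    closest_point (moving_box H lo hi x) (x - r *\<^sub>R (A *v x + As *v y) - r *\<^sub>R a)"

text \<open>Worst case over the interval matrix of the coefficient with which a change in own
  coordinate \<open>k\<close> reaches coordinate \<open>i\<close>. The identity part contributes
  only on the diagonal; there the sign condition (A2) or (A3) replaces an absolute value by its
  argument, which is largest at the lower bound \<open>X\<close>.\<close>

definition own_gain ::
  "real \<Rightarrow> real ^ 'd ^ 'd \<Rightarrow> real ^ 'd ^ 'd \<Rightarrow> real ^ 'd ^ 'd \<Rightarrow> 'd \<Rightarrow> 'd \<Rightarrow> real"
  where "own_gain r H X Y i k = (if k = i then 1 - r * X $ i $ i - H $ i $ i + \<bar>H $ i $ i\<bar>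
    else shifted_entry_bound r H X Y i k + \<bar>H $ i $ k\<bar>)"

lemma abs_entry_le_entry_bound:
  assumes "M \<in> {X..Y}"
  shows "\<bar>M $ i $ j\<bar> \<le> entry_bound X Y i j"
proof -
  have "X $ i $ j \<le> M $ i $ j" "M $ i $ j \<le> Y $ i $ j"
    using assms by (auto simp: less_eq_vec_def)
  then show ?thesis unfolding entry_bound_def by linarith
qed

lemma abs_shifted_entry_le_shifted_entry_bound:
  assumes "M \<in> {X..Y}" and "0 \<le> r"
  shows "\<bar>r * M $ i $ j + H $ i $ j\<bar> \<le> shifted_entry_bound r H X Y i j"
proof -
  have "X $ i $ j \<le> M $ i $ j" "M $ i $ j \<le> Y $ i $ j"
    using assms by (auto simp: less_eq_vec_def)
  then have "r * X $ i $ j \<le> r * M $ i $ j" "r * M $ i $ j \<le> r * Y $ i $ j"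
    using \<open>0 \<le> r\<close> by (auto intro: mult_left_mono)
  then show ?thesis unfolding shifted_entry_bound_def by linarith
qed

text \<open>The vector \<open>H *v x\<close> enters twice: it translates the box, and it is
  subtracted inside the clamp. The two contributions are estimated separately, which is why
  \<open>H\<close> appears both in the shifted entries and in an additional absolute value.\<close>

lemma projection_step_lipschitz:
  fixes A :: "real ^ 'd ^ 'd" and As :: "real ^ 'e ^ 'd"
  assumes "lo \<le> hi" and "0 \<le> r" and A: "A \<in> {Al..Au}" and As: "As \<in> {Asl..Asu}"
    and diag: "1 - r * Au $ i $ i \<ge> H $ i $ i"
  shows "\<bar>(projection_step H lo hi r a A As x y - projection_step H lo hi r a A As x' y') $ i\<bar>
    \<le> (\<Sum>k\<in>UNIV. own_gain r H Al Au i k * \<bar>(x - x') $ k\<bar>)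
      + (\<Sum>k\<in>UNIV. r * entry_bound Asl Asu i k * \<bar>(y - y') $ k\<bar>)"
proof -
  \<comment> \<open>Row \<open>i\<close> of the identity minus \<open>r\<close> times
    \<open>A\<close> minus \<open>H\<close>, the own-variable part of the clamp's argument
    \<open>z\<close>.\<close>
  define g where "g k = (if k = i then 1 else 0) - r * A $ i $ k - H $ i $ k" for k
  define z where "z x y = x - r *\<^sub>R (A *v x + As *v y) - r *\<^sub>R a - H *v x" for x y
  have g_sum: "(\<Sum>k\<in>UNIV. g k * v $ k) = v $ i - r * (A *v v) $ i - (H *v v) $ i" for v
  proof -
    have "(\<Sum>k\<in>UNIV. (if k = i then 1 else 0) * v $ k) = v $ i"
      by (simp add: if_distrib[of "\<lambda>c. c * _"] cong: if_cong)
    then show ?thesis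
      by (simp add: g_def matrix_vector_mult_def left_diff_distrib sum_subtractf
          sum_distrib_left mult.assoc)
  qed
  have As_sum: "(\<Sum>k\<in>UNIV. r * As $ i $ k * v $ k) = r * (As *v v) $ i" for v
    by (simp add: matrix_vector_mult_def sum_distrib_left mult.assoc)
  have z_diff: "(z x y - z x' y') $ i =
      (\<Sum>k\<in>UNIV. g k * (x - x') $ k) - (\<Sum>k\<in>UNIV. r * As $ i $ k * (y - y') $ k)"
    unfolding g_sum As_sum z_def
    by (simp add: matrix_vector_mult_diff_distrib algebra_simps)
  have H_diff: "(H *v x - H *v x') $ i = (\<Sum>k\<in>UNIV. H $ i $ k * (x - x') $ k)"
    by (simp add: matrix_vector_mult_def right_diff_distrib sum_subtractf)
  have own: "\<bar>H $ i $ k\<bar> + \<bar>g k\<bar> \<le> own_gain r H Al Au i k" for k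
  proof (cases "k = i")
    case True
    have "Al $ i $ i \<le> A $ i $ i" "A $ i $ i \<le> Au $ i $ i"
      using A by (auto simp: less_eq_vec_def)
    then have "r * Al $ i $ i \<le> r * A $ i $ i" "r * A $ i $ i \<le> r * Au $ i $ i"
      using \<open>0 \<le> r\<close> by (auto intro: mult_left_mono)
    then show ?thesis
      using True diag by (simp add: own_gain_def g_def)
  next
    case False
    then show ?thesis
      using abs_shifted_entry_le_shifted_entry_bound[OF A \<open>0 \<le> r\<close>, of i k H]
      by (simp add: own_gain_def g_def)
  qed
  have cross: "\<bar>r * As $ i $ k\<bar> \<le> r * entry_bound Asl Asu i k" for k
    using abs_entry_le_entry_bound[OF As, of i k] \<open>0 \<le> r\<close>
    by (simp add: abs_mult mult_left_mono)
  \<comment> \<open>Clamping to a fixed interval does not increase distances, so only the shift of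
    the box and the change of \<open>z\<close> remain.\<close>
  have "\<bar>(projection_step H lo hi r a A As x y - projection_step H lo hi r a A As x' y') $ i\<bar>
      \<le> \<bar>(H *v x - H *v x') $ i\<bar> + \<bar>(z x y - z x' y') $ i\<bar>"
    unfolding projection_step_def z_def vector_minus_component
      closest_point_moving_box_nth[OF \<open>lo \<le> hi\<close>]
    by (smt (verit, best))
  also have "\<dots> \<le> (\<Sum>k\<in>UNIV. \<bar>H $ i $ k * (x - x') $ k\<bar>) + ((\<Sum>k\<in>UNIV. \<bar>g k * (x - x') $ k\<bar>)
      + (\<Sum>k\<in>UNIV. \<bar>r * As $ i $ k * (y - y') $ k\<bar>))"
    unfolding z_diff H_diff
    by (intro add_mono order_trans[OF abs_triangle_ineq4] sum_abs)
  also have "\<dots> = (\<Sum>k\<in>UNIV. (\<bar>H $ i $ k\<bar> + \<bar>g k\<bar>) * \<bar>(x - x') $ k\<bar>)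
      + (\<Sum>k\<in>UNIV. \<bar>r * As $ i $ k\<bar> * \<bar>(y - y') $ k\<bar>)"
    by (simp only: abs_mult distrib_right sum.distrib add.assoc)
  also have "\<dots> \<le> (\<Sum>k\<in>UNIV. own_gain r H Al Au i k * \<bar>(x - x') $ k\<bar>)
      + (\<Sum>k\<in>UNIV. r * entry_bound Asl Asu i k * \<bar>(y - y') $ k\<bar>)"
    by (intro add_mono sum_mono mult_right_mono own cross) auto
  finally show ?thesis .
qed

section \<open>Weighted column sums\<close>

text \<open>Clears the denominators \<open>\<mu> i\<close> of (A4), turning its normalized
  expression into a weighted column sum of the gain matrix. Here \<open>s * e j\<close> stands for
  the coupling into the other block.\<close>

lemma weighted_sum_own_gain:
  fixes \<mu> :: "'d::finite \<Rightarrow> real"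
  assumes "\<mu> i > 0"
  shows "(\<Sum>k\<in>UNIV. \<mu> k * own_gain r H X Y k i) + (\<Sum>j\<in>UNIV. \<tau> j * (s * e j)) =
    \<mu> i * (1 - r * X $ i $ i - H $ i $ i + \<bar>H $ i $ i\<bar>
      + (\<Sum>k\<in>UNIV - {i}. \<mu> k / \<mu> i * (shifted_entry_bound r H X Y k i + \<bar>H $ k $ i\<bar>))
      + (\<Sum>j\<in>UNIV. \<tau> j / \<mu> i * s * e j))"
proof -
  have "(\<Sum>k\<in>UNIV. \<mu> k * own_gain r H X Y k i) = \<mu> i * own_gain r H X Y i i
      + (\<Sum>k\<in>UNIV - {i}. \<mu> k * own_gain r H X Y k i)"
    by (rule sum.remove) auto
  also have "(\<Sum>k\<in>UNIV - {i}. \<mu> k * own_gain r H X Y k i) =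
      (\<Sum>k\<in>UNIV - {i}. \<mu> k * (shifted_entry_bound r H X Y k i + \<bar>H $ k $ i\<bar>))"
    by (intro sum.cong) (auto simp: own_gain_def)
  finally show ?thesis
    using assms by (simp add: own_gain_def distrib_left sum_distrib_left mult.assoc)
qed

text \<open>For a weighted l1 norm the operator bound is read off from columns: exchanging the order
  of summation collects, for each input coordinate, its total weighted effect on both
  blocks.\<close>

lemma weighted_sum_bilinear_le:
  fixes K :: "'n::finite \<Rightarrow> 'n \<Rightarrow> real" and M :: "'n \<Rightarrow> 'm::finite \<Rightarrow> real"
    and K' :: "'m \<Rightarrow> 'm \<Rightarrow> real" and M' :: "'m \<Rightarrow> 'n \<Rightarrow> real"
  assumes col: "\<And>i. (\<Sum>k\<in>UNIV. \<mu> k * K k i) + (\<Sum>j\<in>UNIV. \<tau> j * M' j i) \<le> q * \<mu> i"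
    and col': "\<And>j. (\<Sum>k\<in>UNIV. \<tau> k * K' k j) + (\<Sum>i\<in>UNIV. \<mu> i * M i j) \<le> q * \<tau> j"
    and u: "\<And>i. 0 \<le> u i" and v: "\<And>j. 0 \<le> v j"
  shows "(\<Sum>i\<in>UNIV. \<mu> i * ((\<Sum>k\<in>UNIV. K i k * u k) + (\<Sum>k\<in>UNIV. M i k * v k)))
      + (\<Sum>j\<in>UNIV. \<tau> j * ((\<Sum>k\<in>UNIV. K' j k * v k) + (\<Sum>k\<in>UNIV. M' j k * u k)))
    \<le> q * ((\<Sum>i\<in>UNIV. \<mu> i * u i) + (\<Sum>j\<in>UNIV. \<tau> j * v j))" (is "?l \<le> ?r")
proof -
  \<comment> \<open>The index types are left general because all four blocks, square and
    rectangular, are treated by this identity.\<close>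
  have swap: "(\<Sum>i\<in>UNIV. w i * (\<Sum>k\<in>UNIV. G i k * t k)) =
      (\<Sum>k\<in>UNIV. (\<Sum>i\<in>UNIV. w i * G i k) * t k)"
    for w :: "'x::finite \<Rightarrow> real" and G and t :: "'y::finite \<Rightarrow> real"
    by (simp add: sum_distrib_left sum_distrib_right mult.assoc) (rule sum.swap)
  have "?l = (\<Sum>i\<in>UNIV. ((\<Sum>k\<in>UNIV. \<mu> k * K k i) + (\<Sum>j\<in>UNIV. \<tau> j * M' j i)) * u i)
      + (\<Sum>j\<in>UNIV. ((\<Sum>k\<in>UNIV. \<tau> k * K' k j) + (\<Sum>i\<in>UNIV. \<mu> i * M i j)) * v j)"
    by (simp add: distrib_left distrib_right sum.distrib swap)
  also have "\<dots> \<le> (\<Sum>i\<in>UNIV. q * \<mu> i * u i) + (\<Sum>j\<in>UNIV. q * \<tau> j * v j)"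
    by (intro add_mono sum_mono mult_right_mono col col' u v)
  also have "\<dots> = ?r"
    by (simp add: distrib_left sum_distrib_left mult.assoc)
  finally show ?thesis .
qed

section \<open>Comparison of the weighted l1 norm with the Euclidean norm\<close>

definition weighted_l1 :: "('n \<Rightarrow> real) \<Rightarrow> real ^ 'n \<Rightarrow> real"
  where "weighted_l1 \<mu> x = (\<Sum>i\<in>UNIV. \<mu> i * \<bar>x $ i\<bar>)"

lemma weighted_l1_nonneg:
  assumes "\<And>i. \<mu> i > 0"
  shows "0 \<le> weighted_l1 \<mu> x"
  unfolding weighted_l1_def using assms by (intro sum_nonneg) (simp add: less_imp_le)

text \<open>Each term \<open>\<mu> i * \<bar>x $ i\<bar>\<close> is at most the whole sum; dividing
  by the weight and summing bounds the plain l1 norm, hence the Euclidean one. This and the reverse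
  comparison supply the constants \<open>C\<close> and \<open>D\<close> of
  \<open>banach_fix_equivalent_norm\<close>.\<close>

lemma norm_le_weighted_l1:
  assumes pos: "\<And>i. \<mu> i > 0"
  shows "norm x \<le> (\<Sum>i\<in>UNIV. 1 / \<mu> i) * weighted_l1 \<mu> x"
proof -
  have "\<mu> i * \<bar>x $ i\<bar> \<le> weighted_l1 \<mu> x" for i
    unfolding weighted_l1_def using pos
    by (intro member_le_sum) (auto simp: less_imp_le)
  then have "(\<Sum>i\<in>UNIV. \<bar>x $ i\<bar>) \<le> (\<Sum>i\<in>UNIV. 1 / \<mu> i * weighted_l1 \<mu> x)"
    using pos by (intro sum_mono) (simp add: field_simps)
  with norm_le_l1_cart[of x] show ?thesis
    by (simp add: sum_distrib_right)
qed

lemma weighted_l1_le_norm: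
  assumes "\<And>i. \<mu> i > 0"
  shows "weighted_l1 \<mu> x \<le> (\<Sum>i\<in>UNIV. \<mu> i) * norm x"
  unfolding weighted_l1_def sum_distrib_right
  using assms by (intro sum_mono mult_left_mono component_le_norm_cart) (simp add: less_imp_le)

section \<open>Existence and uniqueness of the equilibrium\<close>

theorem theorem3p1:
  fixes Al Au :: "real ^ 'n ^ 'n" and Asl Asu :: "real ^ 'm ^ 'n"
    and Bl Bu :: "real ^ 'm ^ 'm" and Bsl Bsu :: "real ^ 'n ^ 'm"
    and H :: "real ^ 'n ^ 'n" and L :: "real ^ 'm ^ 'm"
    and c1 c2 a :: "real ^ 'n" and d1 d2 b :: "real ^ 'm"
    and \<rho> lam :: real
  assumes "Al \<le> Au" and "Asl \<le> Asu" and "Bl \<le> Bu" and "Bsl \<le> Bsu"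
    and "c1 \<le> c2" and "d1 \<le> d2"
    and "\<rho> > 0" and "lam > 0"
    and A2: "\<forall>i. 1 - \<rho> * Au $ i $ i \<ge> H $ i $ i"
    and A3: "\<forall>j. 1 - lam * Bu $ j $ j \<ge> L $ j $ j"
    and A4: "\<exists>(\<mu> :: 'n \<Rightarrow> real) (\<tau> :: 'm \<Rightarrow> real).
      (\<forall>i. \<mu> i > 0) \<and> (\<forall>j. \<tau> j > 0) \<and>
      (\<forall>i. let s = 1 - \<rho> * Al $ i $ i - H $ i $ i + \<bar>H $ i $ i\<bar>
              + (\<Sum>j\<in>UNIV - {i}. \<mu> j / \<mu> i * (shifted_entry_bound \<rho> H Al Au j i + \<bar>H $ j $ i\<bar>))
              + (\<Sum>j\<in>UNIV. \<tau> j / \<mu> i * lam * entry_bound Bsl Bsu j i)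
           in 0 < s \<and> s < 1) \<and>
      (\<forall>j. let s = 1 - lam * Bl $ j $ j - L $ j $ j + \<bar>L $ j $ j\<bar>
              + (\<Sum>i\<in>UNIV - {j}. \<tau> i / \<tau> j * (shifted_entry_bound lam L Bl Bu i j + \<bar>L $ i $ j\<bar>))
              + (\<Sum>i\<in>UNIV. \<mu> i / \<tau> j * \<rho> * entry_bound Asl Asu i j)
           in 0 < s \<and> s < 1)"
  shows "\<forall>A\<in>{Al..Au}. \<forall>As\<in>{Asl..Asu}. \<forall>B\<in>{Bl..Bu}. \<forall>Bs\<in>{Bsl..Bsu}.
    \<exists>!p. equilibrium_point (moving_box H c1 c2) (moving_box L d1 d2) \<rho> lam a b A As B Bs p"
proof (intro ballI)
  fix A As B Bs
  assume A: "A \<in> {Al..Au}" and As: "As \<in> {Asl..Asu}" and B: "B \<in> {Bl..Bu}" and Bs: "Bs \<in> {Bsl..Bsu}"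
  obtain \<mu> :: "'n \<Rightarrow> real" and \<tau> :: "'m \<Rightarrow> real"
    where \<mu>: "\<And>i. \<mu> i > 0" and \<tau>: "\<And>j. \<tau> j > 0"
      and S: "\<And>i. 0 < 1 - \<rho> * Al $ i $ i - H $ i $ i + \<bar>H $ i $ i\<bar>
              + (\<Sum>j\<in>UNIV - {i}. \<mu> j / \<mu> i * (shifted_entry_bound \<rho> H Al Au j i + \<bar>H $ j $ i\<bar>))
              + (\<Sum>j\<in>UNIV. \<tau> j / \<mu> i * lam * entry_bound Bsl Bsu j i)
          \<and> 1 - \<rho> * Al $ i $ i - H $ i $ i + \<bar>H $ i $ i\<bar>
              + (\<Sum>j\<in>UNIV - {i}. \<mu> j / \<mu> i * (shifted_entry_bound \<rho> H Al Au j i + \<bar>H $ j $ i\<bar>))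
              + (\<Sum>j\<in>UNIV. \<tau> j / \<mu> i * lam * entry_bound Bsl Bsu j i) < 1"
        (is "\<And>i. 0 < ?s i \<and> ?s i < 1")
      and S': "\<And>j. 0 < 1 - lam * Bl $ j $ j - L $ j $ j + \<bar>L $ j $ j\<bar>
              + (\<Sum>i\<in>UNIV - {j}. \<tau> i / \<tau> j * (shifted_entry_bound lam L Bl Bu i j + \<bar>L $ i $ j\<bar>))
              + (\<Sum>i\<in>UNIV. \<mu> i / \<tau> j * \<rho> * entry_bound Asl Asu i j)
          \<and> 1 - lam * Bl $ j $ j - L $ j $ j + \<bar>L $ j $ j\<bar>
              + (\<Sum>i\<in>UNIV - {j}. \<tau> i / \<tau> j * (shifted_entry_bound lam L Bl Bu i j + \<bar>L $ i $ j\<bar>))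
              + (\<Sum>i\<in>UNIV. \<mu> i / \<tau> j * \<rho> * entry_bound Asl Asu i j) < 1"
        (is "\<And>j. 0 < ?t j \<and> ?t j < 1")
    using A4 unfolding Let_def by blast
  \<comment> \<open>A single contraction factor for all columns. The maximum over finitely many
    indices is attained, so the strict upper bounds in (A4) survive as \<open>q < 1\<close>; the
    lower bounds give \<open>0 \<le> q\<close>.\<close>
  define q where "q = Max (range ?s \<union> range ?t)"
  have s_le: "?s i \<le> q" and t_le: "?t j \<le> q" for i j
    unfolding q_def by (rule Max_ge; simp)+
  have q0: "0 \<le> q"
    using S s_le by (meson less_imp_le order_trans)
  have "q \<in> range ?s \<union> range ?t"
    unfolding q_def by (rule Max_in) auto
  then have q1: "q < 1"
    using S S' by auto
  \<comment> \<open>The coupling term comes from \<open>Bs\<close>, not \<open>As\<close>: column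
    \<open>i\<close> belongs to a coordinate of \<open>x\<close>, which acts on the other block
    through the \<open>y\<close>-equation.\<close>
  have col: "(\<Sum>k\<in>UNIV. \<mu> k * own_gain \<rho> H Al Au k i)
      + (\<Sum>j\<in>UNIV. \<tau> j * (lam * entry_bound Bsl Bsu j i)) \<le> q * \<mu> i" for i
    unfolding weighted_sum_own_gain[OF \<mu>] mult.commute[of q]
    using s_le \<mu> by (intro mult_left_mono) (auto simp: less_imp_le)
  have col': "(\<Sum>k\<in>UNIV. \<tau> k * own_gain lam L Bl Bu k j)
      + (\<Sum>i\<in>UNIV. \<mu> i * (\<rho> * entry_bound Asl Asu i j)) \<le> q * \<tau> j" for j
    unfolding weighted_sum_own_gain[OF \<tau>] mult.commute[of q]
    using t_le \<tau> by (intro mult_left_mono) (auto simp: less_imp_le)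
  define T where "T p = (projection_step H c1 c2 \<rho> a A As (fst p) (snd p),
    projection_step L d1 d2 lam b B Bs (snd p) (fst p))" for p
  define N where "N p = weighted_l1 \<mu> (fst p) + weighted_l1 \<tau> (snd p)" for p
  have "\<exists>!p. T p = p"
  proof (rule banach_fix_equivalent_norm)
    show "0 \<le> (\<Sum>i\<in>UNIV. 1 / \<mu> i) + (\<Sum>j\<in>UNIV. 1 / \<tau> j)"
      "0 \<le> (\<Sum>i\<in>UNIV. \<mu> i) + (\<Sum>j\<in>UNIV. \<tau> j)"
      using \<mu> \<tau> by (auto intro!: add_nonneg_nonneg sum_nonneg simp: less_imp_le)
    show "norm p \<le> ((\<Sum>i\<in>UNIV. 1 / \<mu> i) + (\<Sum>j\<in>UNIV. 1 / \<tau> j)) * N p" for p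
    proof -
      have "norm p \<le> norm (fst p) + norm (snd p)"
        using norm_Pair_le[of "fst p" "snd p"] by simp
      also have "\<dots> \<le> (\<Sum>i\<in>UNIV. 1 / \<mu> i) * weighted_l1 \<mu> (fst p)
          + (\<Sum>j\<in>UNIV. 1 / \<tau> j) * weighted_l1 \<tau> (snd p)"
        using \<mu> \<tau> by (intro add_mono norm_le_weighted_l1)
      \<comment> \<open>Both weighted norms are nonnegative, so each is at most their sum
        \<open>N p\<close>; the constants of the two blocks then add up.\<close>
      also have "\<dots> \<le> (\<Sum>i\<in>UNIV. 1 / \<mu> i) * N p + (\<Sum>j\<in>UNIV. 1 / \<tau> j) * N p"
        unfolding N_def
        using \<mu> \<tau> weighted_l1_nonneg[of \<mu> "fst p"] weighted_l1_nonneg[of \<tau> "snd p"]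
        by (intro add_mono mult_left_mono sum_nonneg) (auto simp: less_imp_le)
      finally show ?thesis by (simp add: distrib_right)
    qed
    show "N p \<le> ((\<Sum>i\<in>UNIV. \<mu> i) + (\<Sum>j\<in>UNIV. \<tau> j)) * norm p" for p
    proof -
      have "N p \<le> (\<Sum>i\<in>UNIV. \<mu> i) * norm (fst p) + (\<Sum>j\<in>UNIV. \<tau> j) * norm (snd p)"
        unfolding N_def using \<mu> \<tau> by (intro add_mono weighted_l1_le_norm)
      also have "\<dots> \<le> (\<Sum>i\<in>UNIV. \<mu> i) * norm p + (\<Sum>j\<in>UNIV. \<tau> j) * norm p"
        using \<mu> \<tau> norm_fst_le[of "fst p" "snd p"] norm_snd_le[of "snd p" "fst p"]
        by (intro add_mono mult_left_mono sum_nonneg) (auto simp: less_imp_le)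
      finally show ?thesis by (simp add: distrib_right)
    qed
    show "N (T p - T p') \<le> q * N (p - p')" for p p'
    proof -
      let ?x = "fst p - fst p'" and ?y = "snd p - snd p'"
      have "N (T p - T p') \<le>
          (\<Sum>i\<in>UNIV. \<mu> i * ((\<Sum>k\<in>UNIV. own_gain \<rho> H Al Au i k * \<bar>?x $ k\<bar>)
            + (\<Sum>k\<in>UNIV. \<rho> * entry_bound Asl Asu i k * \<bar>?y $ k\<bar>)))
          + (\<Sum>j\<in>UNIV. \<tau> j * ((\<Sum>k\<in>UNIV. own_gain lam L Bl Bu j k * \<bar>?y $ k\<bar>)
            + (\<Sum>k\<in>UNIV. lam * entry_bound Bsl Bsu j k * \<bar>?x $ k\<bar>)))"
        unfolding N_def T_def weighted_l1_def fst_diff snd_diff fst_conv snd_conv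
        using \<mu> \<tau> A2 A3 \<open>\<rho> > 0\<close> \<open>lam > 0\<close>
        by (intro add_mono[of "sum _ _"] sum_mono mult_left_mono projection_step_lipschitz
            \<open>c1 \<le> c2\<close> \<open>d1 \<le> d2\<close> A As B Bs) (auto simp: less_imp_le)
      also have "\<dots> \<le> q * N (p - p')"
        unfolding N_def weighted_l1_def fst_diff snd_diff
        by (rule weighted_sum_bilinear_le[OF col col']) auto
      finally show ?thesis .
    qed
  qed (fact q0 q1)+
  moreover have "equilibrium_point (moving_box H c1 c2) (moving_box L d1 d2) \<rho> lam a b A As B Bs p
      \<longleftrightarrow> T p = p" for p
    by (cases p) (simp add: equilibrium_point_def T_def projection_step_def)
  ultimately show "\<exists>!p. equilibrium_point (moving_box H c1 c2) (moving_box L d1 d2)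
      \<rho> lam a b A As B Bs p"
    by simp
qed

end
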